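(* A jointly mono span $X_1\xleftarrow{\pi_1}B\xrightarrow{\pi_2}X_2$ is a $\rho$-bisimulation between $T$-coalgebras $(X_1,\gamma_1)$ and $(X_2,\gamma_2)$ if and only if $(B,\pi_1,\pi_2)\le T^\rho_{\gamma_1,\gamma_2}(B,\pi_1,\pi_2)$ in $\mathrm{Rel}(X_1,X_2)$.
   Context: $P\colon\mathcal C\to\mathcal A$, $S\colon\mathcal A\to\mathcal C$ are contravariant functors forming a dual adjunction (natural bijection $\mathcal C(X,SA)\cong\mathcal A(A,PX)$) with unit $\eta^{\mathcal C}\colon\mathrm{Id}_{\mathcal C}\to SP$. $T\colon\mathcal C\to\mathcal C$ is an endofunctor; a $T$-coalgebra is $(X,\gamma)$ with $\gamma\colon X\to TX$. $(L,\rho)$ is a logic: $L\colon\mathcal A\to\mathcal A$, $\rho\colon LP\to PT$ natural; complex algebra $\gamma^*=P\gamma\circ\rho_X$. Standing assumptions: $\mathcal C$ is finitely complete, well-powered, with an $(\mathcal E,\mathrm{Mono})$-factorisation system; $\mathcal A$ has pullbacks or $\mathcal C$ has pushouts. A span is jointly mono if $\pi_1h=\pi_1h'$ and $\pi_2h=\pi_2h'$ imply $h=h'$; $\mathrm{Rel}(X_1,X_2)$ is the poset of jointly mono spans up to isomorphism with $(B,\pi)\le(B',\pi')$ iff some $k\colon B\to B'$ has $\pi_i=\pi_i'k$. The dual span $(\bar B,\bar\pi_1,\bar\pi_2)$ is the pullback in $\mathcal A$ of $PX_1\xrightarrow{P\pi_1}PB\xleftarrow{P\pi_2}PX_2$;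 $(B,\pi_1,\pi_2)$ is a $\rho$-bisimulation if $P\pi_1\circ\gamma_1^*\circ L\bar\pi_1=P\pi_2\circ\gamma_2^*\circ L\bar\pi_2$. Let $\sigma_i=SL\bar\pi_i\circ S\rho_{X_i}\circ\eta^{\mathcal C}_{TX_i}\colon TX_i\to SL\bar B$; $T^\rho_{\gamma_1,\gamma_2}(B,\pi_1,\pi_2)\in\mathrm{Rel}(X_1,X_2)$ is the pullback in $\mathcal C$ of $X_1\xrightarrow{\sigma_1\circ\gamma_1}SL\bar B\xleftarrow{\sigma_2\circ\gamma_2}X_2$. *)

theory Defs
  imports Main "HOL-Library.Equipollence"
begin

section \<open>Categories\<close>

text \<open>Composition is written in the usual order: \<open>g \<cdot> f\<close> is \<open>f\<close> followed by \<open>g\<close>. Its value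
  on non-composable pairs, and all data outside the carriers, are unspecified.\<close>

record ('o, 'a) cat =
  Obj :: "'o set"
  Arr :: "'a set"
  Dom :: "'a \<Rightarrow> 'o"
  Cod :: "'a \<Rightarrow> 'o"
  Ident :: "'o \<Rightarrow> 'a"
  Comp :: "'a \<Rightarrow> 'a \<Rightarrow> 'a"  (infixl "\<cdot>\<index>" 70)

definition Hom :: "('o, 'a) cat \<Rightarrow> 'o \<Rightarrow> 'o \<Rightarrow> 'a set" where
  "Hom C X Y = {f \<in> Arr C. Dom C f = X \<and> Cod C f = Y}"

locale category =
  fixes C :: "('o, 'a) cat" (structure)
  assumes Dom_closed: "f \<in> Arr C \<Longrightarrow> Dom C f \<in> Obj C"
    and Cod_closed: "f \<in> Arr C \<Longrightarrow> Cod C f \<in> Obj C"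
    and Ident_closed: "X \<in> Obj C \<Longrightarrow> Ident C X \<in> Hom C X X"
    and Comp_closed: "f \<in> Hom C X Y \<Longrightarrow> g \<in> Hom C Y Z \<Longrightarrow> g \<cdot> f \<in> Hom C X Z"
    and Ident_right: "f \<in> Hom C X Y \<Longrightarrow> f \<cdot> Ident C X = f"
    and Ident_left: "f \<in> Hom C X Y \<Longrightarrow> Ident C Y \<cdot> f = f"
    and Comp_assoc: "f \<in> Hom C W X \<Longrightarrow> g \<in> Hom C X Y \<Longrightarrow> h \<in> Hom C Y Z \<Longrightarrow>
      h \<cdot> (g \<cdot> f) = (h \<cdot> g) \<cdot> f"

definition op_cat :: "('o, 'a) cat \<Rightarrow> ('o, 'a) cat" where
  "op_cat C = \<lparr>Obj = Obj C, Arr = Arr C, Dom = Cod C, Cod = Dom C,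
     Ident = Ident C, Comp = (\<lambda>g f. f \<cdot>\<^bsub>C\<^esub> g)\<rparr>"

definition monic :: "('o, 'a) cat \<Rightarrow> 'a \<Rightarrow> bool" where
  "monic C m \<longleftrightarrow> m \<in> Arr C \<and>
     (\<forall>Z\<in>Obj C. \<forall>h\<in>Hom C Z (Dom C m). \<forall>h'\<in>Hom C Z (Dom C m).
        m \<cdot>\<^bsub>C\<^esub> h = m \<cdot>\<^bsub>C\<^esub> h' \<longrightarrow> h = h')"

definition is_iso :: "('o, 'a) cat \<Rightarrow> 'a \<Rightarrow> bool" where
  "is_iso C f \<longleftrightarrow> f \<in> Arr C \<and>
     (\<exists>g\<in>Hom C (Cod C f) (Dom C f).
        g \<cdot>\<^bsub>C\<^esub> f = Ident C (Dom C f) \<and> f \<cdot>\<^bsub>C\<^esub> g = Ident C (Cod C f))"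


section \<open>Functors and natural transformations\<close>

record ('o, 'a, 'p, 'b) fctr =
  fobj :: "'o \<Rightarrow> 'p"
  farr :: "'a \<Rightarrow> 'b"

definition is_functor :: "('o, 'a) cat \<Rightarrow> ('p, 'b) cat \<Rightarrow> ('o, 'a, 'p, 'b) fctr \<Rightarrow> bool" where
  "is_functor C D F \<longleftrightarrow>
     (\<forall>X\<in>Obj C. fobj F X \<in> Obj D) \<and>
     (\<forall>X\<in>Obj C. \<forall>Y\<in>Obj C. \<forall>f\<in>Hom C X Y. farr F f \<in> Hom D (fobj F X) (fobj F Y)) \<and>
     (\<forall>X\<in>Obj C. farr F (Ident C X) = Ident D (fobj F X)) \<and>
     (\<forall>X\<in>Obj C. \<forall>Y\<in>Obj C. \<forall>Z\<in>Obj C. \<forall>f\<in>Hom C X Y. \<forall>g\<in>Hom C Y Z.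
        farr F (g \<cdot>\<^bsub>C\<^esub> f) = farr F g \<cdot>\<^bsub>D\<^esub> farr F f)"

definition is_contravariant_functor ::
    "('o, 'a) cat \<Rightarrow> ('p, 'b) cat \<Rightarrow> ('o, 'a, 'p, 'b) fctr \<Rightarrow> bool" where
  "is_contravariant_functor C D F \<longleftrightarrow> is_functor (op_cat C) D F"

definition fcomp :: "('p, 'b, 'q, 'c) fctr \<Rightarrow> ('o, 'a, 'p, 'b) fctr \<Rightarrow> ('o, 'a, 'q, 'c) fctr" where
  "fcomp G F = \<lparr>fobj = fobj G \<circ> fobj F, farr = farr G \<circ> farr F\<rparr>"

definition natural_transformation ::
    "('o, 'a) cat \<Rightarrow> ('p, 'b) cat \<Rightarrow> ('o, 'a, 'p, 'b) fctr \<Rightarrow> ('o, 'a, 'p, 'b) fctr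
      \<Rightarrow> ('o \<Rightarrow> 'b) \<Rightarrow> bool" where
  "natural_transformation C D F G \<alpha> \<longleftrightarrow>
     (\<forall>X\<in>Obj C. \<alpha> X \<in> Hom D (fobj F X) (fobj G X)) \<and>
     (\<forall>X\<in>Obj C. \<forall>Y\<in>Obj C. \<forall>f\<in>Hom C X Y.
        farr G f \<cdot>\<^bsub>D\<^esub> \<alpha> X = \<alpha> Y \<cdot>\<^bsub>D\<^esub> farr F f)"


section \<open>Limits, subobjects and factorisation systems\<close>

definition is_cone ::
    "('j, 'i) cat \<Rightarrow> ('o, 'a) cat \<Rightarrow> ('j, 'i, 'o, 'a) fctr \<Rightarrow> 'o \<Rightarrow> ('j \<Rightarrow> 'a) \<Rightarrow> bool" where
  "is_cone J C D X c \<longleftrightarrow> X \<in> Obj C \<and>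
     (\<forall>j\<in>Obj J. c j \<in> Hom C X (fobj D j)) \<and>
     (\<forall>j\<in>Obj J. \<forall>j'\<in>Obj J. \<forall>u\<in>Hom J j j'. farr D u \<cdot>\<^bsub>C\<^esub> c j = c j')"

definition is_limit ::
    "('j, 'i) cat \<Rightarrow> ('o, 'a) cat \<Rightarrow> ('j, 'i, 'o, 'a) fctr \<Rightarrow> 'o \<Rightarrow> ('j \<Rightarrow> 'a) \<Rightarrow> bool" where
  "is_limit J C D X c \<longleftrightarrow> is_cone J C D X c \<and>
     (\<forall>Y d. is_cone J C D Y d \<longrightarrow> (\<exists>!k. k \<in> Hom C Y X \<and> (\<forall>j\<in>Obj J. c j \<cdot>\<^bsub>C\<^esub> k = d j)))"

text \<open>Every finite category is isomorphic to one whose objects and arrows are natural numbers, so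
  these index categories suffice.\<close>

definition finitely_complete :: "('o, 'a) cat \<Rightarrow> bool" where
  "finitely_complete C \<longleftrightarrow>
     (\<forall>(J :: (nat, nat) cat) D. category J \<and> finite (Obj J) \<and> finite (Arr J) \<and> is_functor J C D
        \<longrightarrow> (\<exists>X c. is_limit J C D X c))"

record ('o, 'a) span =
  apex :: 'o
  leg1 :: 'a
  leg2 :: 'a

definition is_span :: "('o, 'a) cat \<Rightarrow> 'o \<Rightarrow> 'o \<Rightarrow> ('o, 'a) span \<Rightarrow> bool" where
  "is_span C X1 X2 s \<longleftrightarrow>
     apex s \<in> Obj C \<and> leg1 s \<in> Hom C (apex s) X1 \<and> leg2 s \<in> Hom C (apex s) X2"

definition is_pullback :: "('o, 'a) cat \<Rightarrow> 'a \<Rightarrow> 'a \<Rightarrow> ('o, 'a) span \<Rightarrow> bool" where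
  "is_pullback C f g s \<longleftrightarrow>
     f \<in> Arr C \<and> g \<in> Arr C \<and> Cod C f = Cod C g \<and>
     is_span C (Dom C f) (Dom C g) s \<and>
     f \<cdot>\<^bsub>C\<^esub> leg1 s = g \<cdot>\<^bsub>C\<^esub> leg2 s \<and>
     (\<forall>t. is_span C (Dom C f) (Dom C g) t \<and> f \<cdot>\<^bsub>C\<^esub> leg1 t = g \<cdot>\<^bsub>C\<^esub> leg2 t \<longrightarrow>
        (\<exists>!k. k \<in> Hom C (apex t) (apex s) \<and>
              leg1 s \<cdot>\<^bsub>C\<^esub> k = leg1 t \<and> leg2 s \<cdot>\<^bsub>C\<^esub> k = leg2 t))"

text \<open>Pullbacks are determined up to isomorphism only; \<open>pullback\<close> picks one whenever one exists.\<close>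

definition pullback :: "('o, 'a) cat \<Rightarrow> 'a \<Rightarrow> 'a \<Rightarrow> ('o, 'a) span" where
  "pullback C f g = (SOME s. is_pullback C f g s)"

definition has_pullbacks :: "('o, 'a) cat \<Rightarrow> bool" where
  "has_pullbacks C \<longleftrightarrow>
     (\<forall>f\<in>Arr C. \<forall>g\<in>Arr C. Cod C f = Cod C g \<longrightarrow> (\<exists>s. is_pullback C f g s))"

definition has_pushouts :: "('o, 'a) cat \<Rightarrow> bool" where
  "has_pushouts C \<longleftrightarrow> has_pullbacks (op_cat C)"

text \<open>Well-poweredness is relative to a notion of smallness. Here a set counts as small if it
  injects into the parameter \<open>U\<close>: each object has, up to isomorphism of subobjects, only
  \<open>U\<close>-many monomorphisms into it.\<close>

definition well_powered :: "'u set \<Rightarrow> ('o, 'a) cat \<Rightarrow> bool" where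
  "well_powered U C \<longleftrightarrow>
     (\<forall>X\<in>Obj C. \<exists>R. R \<subseteq> {m. monic C m \<and> Cod C m = X} \<and> R \<lesssim> U \<and>
        (\<forall>m. monic C m \<and> Cod C m = X \<longrightarrow>
           (\<exists>r\<in>R. \<exists>k\<in>Hom C (Dom C m) (Dom C r). is_iso C k \<and> m = r \<cdot>\<^bsub>C\<^esub> k)))"

definition factorisation_system :: "('o, 'a) cat \<Rightarrow> 'a set \<Rightarrow> 'a set \<Rightarrow> bool" where
  "factorisation_system C E M \<longleftrightarrow> E \<subseteq> Arr C \<and> M \<subseteq> Arr C \<and>
     \<comment> \<open>both classes are closed under composition with isomorphisms\<close>
     (\<forall>K\<in>{E, M}. \<forall>f\<in>K. \<forall>i. is_iso C i \<longrightarrow>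
        (Dom C i = Cod C f \<longrightarrow> i \<cdot>\<^bsub>C\<^esub> f \<in> K) \<and> (Cod C i = Dom C f \<longrightarrow> f \<cdot>\<^bsub>C\<^esub> i \<in> K)) \<and>
     \<comment> \<open>existence of factorisations\<close>
     (\<forall>f\<in>Arr C. \<exists>e\<in>E. \<exists>m\<in>M. Dom C e = Dom C f \<and> Cod C e = Dom C m \<and> Cod C m = Cod C f \<and>
        f = m \<cdot>\<^bsub>C\<^esub> e) \<and>
     \<comment> \<open>unique diagonal fill-in\<close>
     (\<forall>e\<in>E. \<forall>m\<in>M. \<forall>f\<in>Hom C (Dom C e) (Dom C m). \<forall>g\<in>Hom C (Cod C e) (Cod C m).
        m \<cdot>\<^bsub>C\<^esub> f = g \<cdot>\<^bsub>C\<^esub> e \<longrightarrow>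
        (\<exists>!d. d \<in> Hom C (Cod C e) (Dom C m) \<and> d \<cdot>\<^bsub>C\<^esub> e = f \<and> m \<cdot>\<^bsub>C\<^esub> d = g))"


section \<open>The poset of relations\<close>

definition jointly_mono :: "('o, 'a) cat \<Rightarrow> ('o, 'a) span \<Rightarrow> bool" where
  "jointly_mono C s \<longleftrightarrow>
     (\<forall>Z\<in>Obj C. \<forall>h\<in>Hom C Z (apex s). \<forall>h'\<in>Hom C Z (apex s).
        leg1 s \<cdot>\<^bsub>C\<^esub> h = leg1 s \<cdot>\<^bsub>C\<^esub> h' \<and> leg2 s \<cdot>\<^bsub>C\<^esub> h = leg2 s \<cdot>\<^bsub>C\<^esub> h' \<longrightarrow> h = h')"

definition jm_spans :: "('o, 'a) cat \<Rightarrow> 'o \<Rightarrow> 'o \<Rightarrow> ('o, 'a) span set" where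
  "jm_spans C X1 X2 = {s. is_span C X1 X2 s \<and> jointly_mono C s}"

definition span_iso :: "('o, 'a) cat \<Rightarrow> 'o \<Rightarrow> 'o \<Rightarrow> (('o, 'a) span \<times> ('o, 'a) span) set" where
  "span_iso C X1 X2 = {(s, t). s \<in> jm_spans C X1 X2 \<and> t \<in> jm_spans C X1 X2 \<and>
     (\<exists>k\<in>Hom C (apex s) (apex t). is_iso C k \<and>
        leg1 s = leg1 t \<cdot>\<^bsub>C\<^esub> k \<and> leg2 s = leg2 t \<cdot>\<^bsub>C\<^esub> k)}"

definition Rel :: "('o, 'a) cat \<Rightarrow> 'o \<Rightarrow> 'o \<Rightarrow> ('o, 'a) span set set" where
  "Rel C X1 X2 = jm_spans C X1 X2 // span_iso C X1 X2"

definition rel_class :: "('o, 'a) cat \<Rightarrow> 'o \<Rightarrow> 'o \<Rightarrow> ('o, 'a) span \<Rightarrow> ('o, 'a) span set" where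
  "rel_class C X1 X2 s = span_iso C X1 X2 `` {s}"

definition span_le :: "('o, 'a) cat \<Rightarrow> ('o, 'a) span \<Rightarrow> ('o, 'a) span \<Rightarrow> bool" where
  "span_le C s t \<longleftrightarrow>
     (\<exists>k\<in>Hom C (apex s) (apex t). leg1 s = leg1 t \<cdot>\<^bsub>C\<^esub> k \<and> leg2 s = leg2 t \<cdot>\<^bsub>C\<^esub> k)"

definition rel_le ::
    "('o, 'a) cat \<Rightarrow> 'o \<Rightarrow> 'o \<Rightarrow> ('o, 'a) span set \<Rightarrow> ('o, 'a) span set \<Rightarrow> bool" where
  "rel_le C X1 X2 r r' \<longleftrightarrow> r \<in> Rel C X1 X2 \<and> r' \<in> Rel C X1 X2 \<and>
     (\<exists>s\<in>r. \<exists>t\<in>r'. span_le C s t)"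


section \<open>Dual adjunctions, coalgebras and logics\<close>

text \<open>\<open>\<phi> X Y\<close> is the bijection from \<open>C(X, S Y)\<close> to \<open>A(Y, P X)\<close>.\<close>

definition dual_adjunction ::
    "('o, 'a) cat \<Rightarrow> ('p, 'b) cat \<Rightarrow> ('o, 'a, 'p, 'b) fctr \<Rightarrow> ('p, 'b, 'o, 'a) fctr
      \<Rightarrow> ('o \<Rightarrow> 'p \<Rightarrow> 'a \<Rightarrow> 'b) \<Rightarrow> bool" where
  "dual_adjunction C A P S \<phi> \<longleftrightarrow>
     is_contravariant_functor C A P \<and> is_contravariant_functor A C S \<and>
     (\<forall>X\<in>Obj C. \<forall>Y\<in>Obj A. bij_betw (\<phi> X Y) (Hom C X (fobj S Y)) (Hom A Y (fobj P X))) \<and>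
     (\<forall>X\<in>Obj C. \<forall>X'\<in>Obj C. \<forall>Y\<in>Obj A. \<forall>Y'\<in>Obj A.
        \<forall>f\<in>Hom C X' X. \<forall>u\<in>Hom A Y' Y. \<forall>h\<in>Hom C X (fobj S Y).
          \<phi> X' Y' (farr S u \<cdot>\<^bsub>C\<^esub> h \<cdot>\<^bsub>C\<^esub> f) = farr P f \<cdot>\<^bsub>A\<^esub> \<phi> X Y h \<cdot>\<^bsub>A\<^esub> u)"

definition adj_unit ::
    "('o, 'a) cat \<Rightarrow> ('p, 'b) cat \<Rightarrow> ('o, 'a, 'p, 'b) fctr \<Rightarrow> ('p, 'b, 'o, 'a) fctr
      \<Rightarrow> ('o \<Rightarrow> 'p \<Rightarrow> 'a \<Rightarrow> 'b) \<Rightarrow> 'o \<Rightarrow> 'a" where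
  "adj_unit C A P S \<phi> X =
     the_inv_into (Hom C X (fobj S (fobj P X))) (\<phi> X (fobj P X)) (Ident A (fobj P X))"

definition is_coalgebra :: "('o, 'a) cat \<Rightarrow> ('o, 'a, 'o, 'a) fctr \<Rightarrow> 'o \<Rightarrow> 'a \<Rightarrow> bool" where
  "is_coalgebra C T X \<gamma> \<longleftrightarrow> X \<in> Obj C \<and> \<gamma> \<in> Hom C X (fobj T X)"

text \<open>Both \<open>L P\<close> and \<open>P T\<close> are contravariant, i.e. functors on the opposite category.\<close>

definition is_logic ::
    "('o, 'a) cat \<Rightarrow> ('p, 'b) cat \<Rightarrow> ('o, 'a, 'p, 'b) fctr \<Rightarrow> ('o, 'a, 'o, 'a) fctr
      \<Rightarrow> ('p, 'b, 'p, 'b) fctr \<Rightarrow> ('o \<Rightarrow> 'b) \<Rightarrow> bool" where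
  "is_logic C A P T L \<rho> \<longleftrightarrow>
     is_functor A A L \<and> natural_transformation (op_cat C) A (fcomp L P) (fcomp P T) \<rho>"

definition complex_algebra ::
    "('p, 'b) cat \<Rightarrow> ('o, 'a, 'p, 'b) fctr \<Rightarrow> ('o \<Rightarrow> 'b) \<Rightarrow> 'o \<Rightarrow> 'a \<Rightarrow> 'b" where
  "complex_algebra A P \<rho> X \<gamma> = farr P \<gamma> \<cdot>\<^bsub>A\<^esub> \<rho> X"


section \<open>Bisimulations\<close>

definition dual_span ::
    "('p, 'b) cat \<Rightarrow> ('o, 'a, 'p, 'b) fctr \<Rightarrow> ('o, 'a) span \<Rightarrow> ('p, 'b) span" where
  "dual_span A P s = pullback A (farr P (leg1 s)) (farr P (leg2 s))"

definition rho_bisimulation ::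
    "('p, 'b) cat \<Rightarrow> ('o, 'a, 'p, 'b) fctr \<Rightarrow> ('p, 'b, 'p, 'b) fctr \<Rightarrow> ('o \<Rightarrow> 'b)
      \<Rightarrow> 'o \<Rightarrow> 'a \<Rightarrow> 'o \<Rightarrow> 'a \<Rightarrow> ('o, 'a) span \<Rightarrow> bool" where
  "rho_bisimulation A P L \<rho> X1 \<gamma>1 X2 \<gamma>2 s \<longleftrightarrow>
     farr P (leg1 s) \<cdot>\<^bsub>A\<^esub> complex_algebra A P \<rho> X1 \<gamma>1 \<cdot>\<^bsub>A\<^esub> farr L (leg1 (dual_span A P s)) =
     farr P (leg2 s) \<cdot>\<^bsub>A\<^esub> complex_algebra A P \<rho> X2 \<gamma>2 \<cdot>\<^bsub>A\<^esub> farr L (leg2 (dual_span A P s))"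

text \<open>For a leg \<open>p\<close> of the dual span, an arrow into \<open>P X\<close>, this is \<open>\<sigma>\<close> from \<open>T X\<close> to the image under
  \<open>S L\<close> of the apex of the dual span.\<close>

definition sigma ::
    "('o, 'a) cat \<Rightarrow> ('p, 'b) cat \<Rightarrow> ('o, 'a, 'p, 'b) fctr \<Rightarrow> ('p, 'b, 'o, 'a) fctr
      \<Rightarrow> ('o \<Rightarrow> 'p \<Rightarrow> 'a \<Rightarrow> 'b) \<Rightarrow> ('o, 'a, 'o, 'a) fctr \<Rightarrow> ('p, 'b, 'p, 'b) fctr \<Rightarrow> ('o \<Rightarrow> 'b)
      \<Rightarrow> 'o \<Rightarrow> 'b \<Rightarrow> 'a" where
  "sigma C A P S \<phi> T L \<rho> X p =
     farr S (farr L p) \<cdot>\<^bsub>C\<^esub> farr S (\<rho> X) \<cdot>\<^bsub>C\<^esub> adj_unit C A P S \<phi> (fobj T X)"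

definition T_rho ::
    "('o, 'a) cat \<Rightarrow> ('p, 'b) cat \<Rightarrow> ('o, 'a, 'p, 'b) fctr \<Rightarrow> ('p, 'b, 'o, 'a) fctr
      \<Rightarrow> ('o \<Rightarrow> 'p \<Rightarrow> 'a \<Rightarrow> 'b) \<Rightarrow> ('o, 'a, 'o, 'a) fctr \<Rightarrow> ('p, 'b, 'p, 'b) fctr \<Rightarrow> ('o \<Rightarrow> 'b)
      \<Rightarrow> 'o \<Rightarrow> 'a \<Rightarrow> 'o \<Rightarrow> 'a \<Rightarrow> ('o, 'a) span \<Rightarrow> ('o, 'a) span set" where
  "T_rho C A P S \<phi> T L \<rho> X1 \<gamma>1 X2 \<gamma>2 s =
     rel_class C X1 X2
       (pullback C (sigma C A P S \<phi> T L \<rho> X1 (leg1 (dual_span A P s)) \<cdot>\<^bsub>C\<^esub> \<gamma>1)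
                   (sigma C A P S \<phi> T L \<rho> X2 (leg2 (dual_span A P s)) \<cdot>\<^bsub>C\<^esub> \<gamma>2))"

end

theory Submission
  imports Defs
begin

text \<open>Under the dual adjunction, \<open>\<sigma>\<^sub>i \<cdot> \<gamma>\<^sub>i \<cdot> \<pi>\<^sub>i\<close> is the transpose of
  \<open>P \<pi>\<^sub>i \<cdot> \<gamma>\<^sub>i\<^sup>* \<cdot> L p\<^sub>i\<close>, where \<open>p\<^sub>i\<close> are the legs of the dual span. Hence the span is a
  \<open>\<rho>\<close>-bisimulation iff it is a cone over the cospan of the \<open>\<sigma>\<^sub>i \<cdot> \<gamma>\<^sub>i\<close>, i.e. iff it factors
  through its pullback. If \<open>A\<close> is not assumed to have pullbacks, the dual span
  exists because \<open>P\<close>, being adjoint on the right, sends pushouts to pullbacks.\<close>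

section \<open>Categories and contravariant functors\<close>

lemma HomD:
  assumes "f \<in> Hom C X Y"
  shows "f \<in> Arr C" "Dom C f = X" "Cod C f = Y"
  using assms by (auto simp: Hom_def)

lemma (in category) Hom_Obj:
  assumes "f \<in> Hom C X Y"
  shows "X \<in> Obj C" "Y \<in> Obj C"
  using assms Dom_closed Cod_closed by (auto simp: Hom_def)

lemma op_cat_simps [simp]:
  "Obj (op_cat C) = Obj C" "Arr (op_cat C) = Arr C" "Dom (op_cat C) = Cod C"
  "Cod (op_cat C) = Dom C" "Ident (op_cat C) = Ident C"
  "g \<cdot>\<^bsub>op_cat C\<^esub> f = f \<cdot>\<^bsub>C\<^esub> g"
  "Hom (op_cat C) X Y = Hom C Y X"
  by (auto simp: op_cat_def Hom_def)

lemma contravariant_Obj: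
  "is_contravariant_functor C D F \<Longrightarrow> X \<in> Obj C \<Longrightarrow> fobj F X \<in> Obj D"
  by (simp add: is_contravariant_functor_def is_functor_def)

lemma contravariant_Ident:
  "is_contravariant_functor C D F \<Longrightarrow> X \<in> Obj C \<Longrightarrow> farr F (Ident C X) = Ident D (fobj F X)"
  by (simp add: is_contravariant_functor_def is_functor_def)

lemma (in category) contravariant_Hom:
  assumes "is_contravariant_functor C D F" "f \<in> Hom C X Y"
  shows "farr F f \<in> Hom D (fobj F Y) (fobj F X)"
  using assms Hom_Obj[OF assms(2)]
  by (simp add: is_contravariant_functor_def is_functor_def)

lemma (in category) contravariant_Comp:
  assumes "is_contravariant_functor C D F" "f \<in> Hom C X Y" "g \<in> Hom C Y Z"
  shows "farr F (g \<cdot> f) = farr F f \<cdot>\<^bsub>D\<^esub> farr F g"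
  using assms Hom_Obj[OF assms(2)] Hom_Obj[OF assms(3)]
  by (simp add: is_contravariant_functor_def is_functor_def)

lemma (in category) functor_Hom:
  assumes "is_functor C D F" "f \<in> Hom C X Y"
  shows "farr F f \<in> Hom D (fobj F X) (fobj F Y)"
  using assms Hom_Obj[OF assms(2)] by (simp add: is_functor_def)

section \<open>Pullbacks in finitely complete categories\<close>

text \<open>Objects and their identities are numbered \<open>0, 1, 2\<close>; the arrows \<open>3 : 0 \<rightarrow> 2\<close> and
  \<open>4 : 1 \<rightarrow> 2\<close> form the cospan. In a composite at most one factor is not an identity, and that
  one has the larger number, whence \<open>max\<close>.\<close>

definition cospan_shape :: "(nat, nat) cat" where
  "cospan_shape = \<lparr>Obj = {0, 1, 2}, Arr = {0, 1, 2, 3, 4},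
     Dom = (\<lambda>a. if a = 3 then 0 else if a = 4 then 1 else a),
     Cod = (\<lambda>a. if a = 3 then 2 else if a = 4 then 2 else a),
     Ident = (\<lambda>x. x), Comp = max\<rparr>"

lemma category_cospan_shape: "category cospan_shape"
  by unfold_locales (auto simp: cospan_shape_def Hom_def split: if_splits)

definition cospan_diagram :: "('o, 'a) cat \<Rightarrow> 'a \<Rightarrow> 'a \<Rightarrow> (nat, nat, 'o, 'a) fctr" where
  "cospan_diagram C f g = \<lparr>
     fobj = (\<lambda>i. if i = 0 then Dom C f else if i = 1 then Dom C g else Cod C f),
     farr = (\<lambda>a. if a = 0 then Ident C (Dom C f) else if a = 1 then Ident C (Dom C g)
       else if a = 2 then Ident C (Cod C f) else if a = 3 then f else g)\<rparr>"

lemma (in category) functor_cospan_diagram: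
  assumes "f \<in> Arr C" "g \<in> Arr C" "Cod C f = Cod C g"
  shows "is_functor cospan_shape C (cospan_diagram C f g)"
proof -
  have f: "f \<in> Hom C (Dom C f) (Cod C f)" and g: "g \<in> Hom C (Dom C g) (Cod C f)"
    using assms by (auto simp: Hom_def)
  note objs = Hom_Obj[OF f] Hom_Obj[OF g]
  note ids = objs[THEN Ident_closed]
  \<comment> \<open>Every composable pair in \<open>cospan_shape\<close> contains an identity, so
    preservation of composites reduces to these unit laws in \<open>C\<close>.\<close>
  note units = Ident_left[OF f] Ident_left[OF g] Ident_right[OF f] Ident_right[OF g]
    ids[THEN Ident_left]
  show ?thesis
    unfolding is_functor_def
    using objs ids units f g
    by (auto simp: cospan_shape_def cospan_diagram_def Hom_def split: if_splits)
qed

text \<open>The component at \<open>2\<close> is forced to be the common composite of the other two,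
  so a cone over the cospan carries the same data as a commuting square. This turns limits of this
  shape into pullbacks.\<close>

lemma (in category) cone_cospan_diagram_iff:
  assumes "f \<in> Arr C" "g \<in> Arr C" "Cod C f = Cod C g"
  shows "is_cone cospan_shape C (cospan_diagram C f g) X c \<longleftrightarrow>
    is_span C (Dom C f) (Dom C g) \<lparr>apex = X, leg1 = c 0, leg2 = c 1\<rparr> \<and>
    f \<cdot> c 0 = c 2 \<and> g \<cdot> c 1 = c 2"
    (is "?cone \<longleftrightarrow> ?span")
proof
  \<comment> \<open>Commutativity of the square is the cone condition at the two non-identity
    arrows.\<close>
  have hom: "3 \<in> Hom cospan_shape 0 2" "4 \<in> Hom cospan_shape 1 2"
    by (auto simp: cospan_shape_def Hom_def)
  have obj: "Obj cospan_shape = {0, 1, 2}"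
    by (simp add: cospan_shape_def)
  assume cone: ?cone
  then have X: "X \<in> Obj C"
    and leg: "\<And>j. j \<in> {0, 1, 2} \<Longrightarrow> c j \<in> Hom C X (fobj (cospan_diagram C f g) j)"
    and nat: "\<And>j j' u. j \<in> {0, 1, 2} \<Longrightarrow> j' \<in> {0, 1, 2} \<Longrightarrow> u \<in> Hom cospan_shape j j' \<Longrightarrow>
      farr (cospan_diagram C f g) u \<cdot> c j = c j'"
    unfolding is_cone_def obj by blast+
  show ?span
    using X leg[of 0] leg[of 1] nat[OF _ _ hom(1)] nat[OF _ _ hom(2)]
    by (simp add: is_span_def cospan_diagram_def)
next
  assume span: ?span
  have f: "f \<in> Hom C (Dom C f) (Cod C f)"
    using assms by (auto simp: Hom_def)
  from span have X: "X \<in> Obj C" and c0: "c 0 \<in> Hom C X (Dom C f)"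
    and c1: "c 1 \<in> Hom C X (Dom C g)" and eq: "f \<cdot> c 0 = c 2" "g \<cdot> c 1 = c 2"
    by (auto simp: is_span_def)
  have c2: "c 2 \<in> Hom C X (Cod C f)"
    using Comp_closed[OF c0 f] eq by simp
  \<comment> \<open>At the arrows \<open>3\<close> and \<open>4\<close> the cone condition is
    \<open>eq\<close>; at the identities it is the left unit law.\<close>
  show ?cone
    unfolding is_cone_def
    using X c0 c1 c2 eq Ident_left[OF c0] Ident_left[OF c1] Ident_left[OF c2]
    by (auto simp: cospan_shape_def cospan_diagram_def Hom_def split: if_splits)
qed

lemma (in category) finitely_complete_has_pullbacks:
  assumes "finitely_complete C"
  shows "has_pullbacks C"
  unfolding has_pullbacks_def
proof (intro ballI impI)
  fix f g assume fg: "f \<in> Arr C" "g \<in> Arr C" "Cod C f = Cod C g"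
  note cone_iff = cone_cospan_diagram_iff[OF fg]
  have "finite (Obj cospan_shape)" "finite (Arr cospan_shape)"
    by (auto simp: cospan_shape_def)
  with assms functor_cospan_diagram[OF fg] category_cospan_shape
  obtain X c where lim: "is_limit cospan_shape C (cospan_diagram C f g) X c"
    unfolding finitely_complete_def by blast
  then have cone: "is_cone cospan_shape C (cospan_diagram C f g) X c"
    by (simp add: is_limit_def)
  have f: "f \<in> Hom C (Dom C f) (Cod C f)"
    using fg by (auto simp: Hom_def)
  have c: "c 0 \<in> Hom C X (Dom C f)" "f \<cdot> c 0 = c 2" "g \<cdot> c 1 = c 2"
    using cone unfolding cone_iff by (auto simp: is_span_def)
  have "is_pullback C f g \<lparr>apex = X, leg1 = c 0, leg2 = c 1\<rparr>"
    unfolding is_pullback_def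
  proof (intro conjI allI impI)
    show "is_span C (Dom C f) (Dom C g) \<lparr>apex = X, leg1 = c 0, leg2 = c 1\<rparr>"
      using cone unfolding cone_iff by blast
    fix t assume t: "is_span C (Dom C f) (Dom C g) t \<and> f \<cdot> leg1 t = g \<cdot> leg2 t"
    \<comment> \<open>The square \<open>t\<close> is extended to a cone by its diagonal, the
      component at the vertex \<open>2\<close>.\<close>
    define d where "d = (\<lambda>j::nat. if j = 0 then leg1 t else if j = 1 then leg2 t else f \<cdot> leg1 t)"
    have "is_cone cospan_shape C (cospan_diagram C f g) (apex t) d"
      unfolding cone_iff using t by (simp add: d_def is_span_def)
    with lim have ex1: "\<exists>!k. k \<in> Hom C (apex t) X \<and> (\<forall>j\<in>Obj cospan_shape. c j \<cdot> k = d j)"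
      by (simp add: is_limit_def)
    \<comment> \<open>Since \<open>c 2\<close> is \<open>f \<cdot> c 0\<close>, the equation at
      \<open>2\<close> follows from the one at \<open>0\<close>. Mediating arrows of cones and of
      spans thus coincide, and unique existence carries over.\<close>
    have "(\<forall>j\<in>Obj cospan_shape. c j \<cdot> k = d j) \<longleftrightarrow> c 0 \<cdot> k = leg1 t \<and> c 1 \<cdot> k = leg2 t"
      if k: "k \<in> Hom C (apex t) X" for k
      using Comp_assoc[OF k c(1) f] c(2) by (auto simp: cospan_shape_def d_def)
    with ex1 show "\<exists>!k. k \<in> Hom C (apex t) (apex \<lparr>apex = X, leg1 = c 0, leg2 = c 1\<rparr>) \<and>
        leg1 \<lparr>apex = X, leg1 = c 0, leg2 = c 1\<rparr> \<cdot> k = leg1 t \<and>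
        leg2 \<lparr>apex = X, leg1 = c 0, leg2 = c 1\<rparr> \<cdot> k = leg2 t"
      by (auto cong: conj_cong)
  qed (use fg c in auto)
  then show "\<exists>s. is_pullback C f g s" ..
qed

section \<open>Pullbacks as jointly mono spans and as greatest commuting spans\<close>

lemma is_pullback_pullback:
  assumes "\<exists>s. is_pullback C f g s"
  shows "is_pullback C f g (pullback C f g)"
  unfolding pullback_def using assms by (rule someI_ex)

lemma span_Hom_legs:
  assumes "is_span C X1 X2 s"
  shows "apex s \<in> Obj C" "leg1 s \<in> Hom C (apex s) X1" "leg2 s \<in> Hom C (apex s) X2"
  using assms by (auto simp: is_span_def)

text \<open>Composing the legs with \<open>h\<close> gives a commuting span for which both
  \<open>h\<close> and \<open>h'\<close> are mediating arrows, so uniqueness identifies them. This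
  makes a pullback a representative of an element of \<open>Rel\<close>.\<close>

lemma (in category) pullback_jointly_mono:
  assumes "is_pullback C f g s"
  shows "jointly_mono C s"
  unfolding jointly_mono_def
proof (intro ballI impI, elim conjE)
  fix Z h h'
  assume Z: "Z \<in> Obj C" and h: "h \<in> Hom C Z (apex s)" and h': "h' \<in> Hom C Z (apex s)"
    and eq: "leg1 s \<cdot> h = leg1 s \<cdot> h'" "leg2 s \<cdot> h = leg2 s \<cdot> h'"
  have span: "is_span C (Dom C f) (Dom C g) s" and comm: "f \<cdot> leg1 s = g \<cdot> leg2 s"
    and f: "f \<in> Hom C (Dom C f) (Cod C f)" and g: "g \<in> Hom C (Dom C g) (Cod C f)"
    using assms by (auto simp: is_pullback_def Hom_def)
  note legs = span_Hom_legs[OF span]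
  let ?t = "\<lparr>apex = Z, leg1 = leg1 s \<cdot> h, leg2 = leg2 s \<cdot> h\<rparr>"
  have "is_span C (Dom C f) (Dom C g) ?t"
    using Z Comp_closed[OF h legs(2)] Comp_closed[OF h legs(3)] by (simp add: is_span_def)
  moreover have "f \<cdot> leg1 ?t = g \<cdot> leg2 ?t"
    using Comp_assoc[OF h legs(2) f] Comp_assoc[OF h legs(3) g] comm by simp
  ultimately have "\<exists>!k. k \<in> Hom C (apex ?t) (apex s) \<and> leg1 s \<cdot> k = leg1 ?t \<and> leg2 s \<cdot> k = leg2 ?t"
    using assms unfolding is_pullback_def by blast
  then show "h = h'"
    using h h' eq by auto
qed

text \<open>A witness of \<open>span_le\<close> is a mediating arrow: the universal property
  supplies one for every commuting span, and any span that factors through a commuting square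
  commutes.\<close>

lemma (in category) span_le_pullback_iff:
  assumes pb: "is_pullback C f g t" and s: "is_span C (Dom C f) (Dom C g) s"
  shows "span_le C s t \<longleftrightarrow> f \<cdot> leg1 s = g \<cdot> leg2 s"
proof
  have span: "is_span C (Dom C f) (Dom C g) t" and comm: "f \<cdot> leg1 t = g \<cdot> leg2 t"
    and f: "f \<in> Hom C (Dom C f) (Cod C f)" and g: "g \<in> Hom C (Dom C g) (Cod C f)"
    using pb by (auto simp: is_pullback_def Hom_def)
  note legs = span_Hom_legs[OF span]
  assume "span_le C s t"
  then obtain k where k: "k \<in> Hom C (apex s) (apex t)"
    and eq: "leg1 s = leg1 t \<cdot> k" "leg2 s = leg2 t \<cdot> k"
    unfolding span_le_def by blast
  show "f \<cdot> leg1 s = g \<cdot> leg2 s"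
    unfolding eq using Comp_assoc[OF k legs(2) f] Comp_assoc[OF k legs(3) g] comm by simp
next
  assume "f \<cdot> leg1 s = g \<cdot> leg2 s"
  with pb s obtain k where "k \<in> Hom C (apex s) (apex t)" "leg1 t \<cdot> k = leg1 s" "leg2 t \<cdot> k = leg2 s"
    unfolding is_pullback_def by metis
  then show "span_le C s t"
    unfolding span_le_def by metis
qed

section \<open>The order on relations\<close>

lemma (in category) span_le_trans:
  assumes st: "span_le C s t" and tu: "span_le C t u" and u: "is_span C X1 X2 u"
  shows "span_le C s u"
proof -
  obtain k where k: "k \<in> Hom C (apex s) (apex t)" "leg1 s = leg1 t \<cdot> k" "leg2 s = leg2 t \<cdot> k"
    using st unfolding span_le_def by blast
  obtain l where l: "l \<in> Hom C (apex t) (apex u)" "leg1 t = leg1 u \<cdot> l" "leg2 t = leg2 u \<cdot> l"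
    using tu unfolding span_le_def by blast
  note legs = span_Hom_legs[OF u]
  show ?thesis
    unfolding span_le_def
  proof (intro bexI conjI)
    show "l \<cdot> k \<in> Hom C (apex s) (apex u)"
      by (rule Comp_closed[OF k(1) l(1)])
    show "leg1 s = leg1 u \<cdot> (l \<cdot> k)" "leg2 s = leg2 u \<cdot> (l \<cdot> k)"
      using Comp_assoc[OF k(1) l(1) legs(2)] Comp_assoc[OF k(1) l(1) legs(3)] k l by simp_all
  qed
qed

text \<open>The isomorphism witnesses one inequality and its inverse the other.\<close>

lemma (in category) span_iso_span_le:
  assumes "(s, t) \<in> span_iso C X1 X2"
  shows "span_le C s t" "span_le C t s"
proof -
  have t: "is_span C X1 X2 t"
    using assms by (simp add: span_iso_def jm_spans_def)
  obtain k where k: "k \<in> Hom C (apex s) (apex t)" and iso: "is_iso C k"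
    and eq: "leg1 s = leg1 t \<cdot> k" "leg2 s = leg2 t \<cdot> k"
    using assms by (auto simp: span_iso_def)
  then show "span_le C s t"
    unfolding span_le_def by blast
  obtain l where l: "l \<in> Hom C (apex t) (apex s)" and inv: "k \<cdot> l = Ident C (apex t)"
    using iso unfolding is_iso_def HomD(2)[OF k] HomD(3)[OF k] by blast
  note legs = span_Hom_legs[OF t]
  have "leg1 t = leg1 s \<cdot> l" "leg2 t = leg2 s \<cdot> l"
    using Comp_assoc[OF l k legs(2)] Comp_assoc[OF l k legs(3)] inv eq
      Ident_right[OF legs(2)] Ident_right[OF legs(3)] by simp_all
  with l show "span_le C t s"
    unfolding span_le_def by blast
qed

lemma (in category) span_iso_refl:
  assumes "s \<in> jm_spans C X1 X2"
  shows "(s, s) \<in> span_iso C X1 X2"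
proof -
  have "is_span C X1 X2 s"
    using assms by (simp add: jm_spans_def)
  note legs = span_Hom_legs[OF this]
  note id = Ident_closed[OF legs(1)]
  have "is_iso C (Ident C (apex s))"
    unfolding is_iso_def HomD(2)[OF id] HomD(3)[OF id]
    using HomD(1)[OF id] id Ident_left[OF id] by blast
  then show ?thesis
    unfolding span_iso_def
    using assms id Ident_right[OF legs(2)] Ident_right[OF legs(3)] by force
qed

text \<open>The order on classes asks only for some pair of comparable representatives; this shows
  that the choice of representatives is immaterial.\<close>

lemma (in category) rel_le_rel_class_iff:
  assumes s: "s \<in> jm_spans C X1 X2" and t: "t \<in> jm_spans C X1 X2"
  shows "rel_le C X1 X2 (rel_class C X1 X2 s) (rel_class C X1 X2 t) \<longleftrightarrow> span_le C s t"
proof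
  assume "rel_le C X1 X2 (rel_class C X1 X2 s) (rel_class C X1 X2 t)"
  then obtain s' t' where s': "(s, s') \<in> span_iso C X1 X2" and t': "(t, t') \<in> span_iso C X1 X2"
    and le: "span_le C s' t'"
    unfolding rel_le_def rel_class_def by blast
  have "is_span C X1 X2 t" "is_span C X1 X2 t'"
    using t t' by (auto simp: span_iso_def jm_spans_def)
  \<comment> \<open>Transitivity along the chain \<open>s\<close>, \<open>s'\<close>,
    \<open>t'\<close>, \<open>t\<close>, whose outer links come from the span isomorphisms.\<close>
  then show "span_le C s t"
    using span_le_trans span_iso_span_le[OF s'] span_iso_span_le[OF t'] le by meson
next
  assume "span_le C s t"
  moreover have "rel_class C X1 X2 r \<in> Rel C X1 X2" if "r \<in> jm_spans C X1 X2" for r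
    unfolding rel_class_def Rel_def using that by (rule quotientI)
  ultimately show "rel_le C X1 X2 (rel_class C X1 X2 s) (rel_class C X1 X2 t)"
    unfolding rel_le_def rel_class_def
    using s t span_iso_refl[OF s] span_iso_refl[OF t] by blast
qed

section \<open>Dual adjunctions\<close>

locale dual_adjoint = C: category C + A: category A
  for C :: "('o, 'a) cat" and A :: "('p, 'b) cat" +
  fixes P :: "('o, 'a, 'p, 'b) fctr" and S :: "('p, 'b, 'o, 'a) fctr"
    and \<phi> :: "'o \<Rightarrow> 'p \<Rightarrow> 'a \<Rightarrow> 'b"
  assumes adj: "dual_adjunction C A P S \<phi>"
begin

lemma P: "is_contravariant_functor C A P"
  and S: "is_contravariant_functor A C S"
  using adj by (auto simp: dual_adjunction_def)

lemma transpose_bij: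
  assumes "X \<in> Obj C" "Y \<in> Obj A"
  shows "bij_betw (\<phi> X Y) (Hom C X (fobj S Y)) (Hom A Y (fobj P X))"
  using adj assms by (auto simp: dual_adjunction_def)

lemma transpose_Hom:
  assumes "h \<in> Hom C X (fobj S Y)" "Y \<in> Obj A"
  shows "\<phi> X Y h \<in> Hom A Y (fobj P X)"
  using transpose_bij[OF C.Hom_Obj(1)[OF assms(1)] assms(2)] assms(1) by (rule bij_betwE[rule_format])

lemma transpose_eq_iff:
  assumes "h \<in> Hom C X (fobj S Y)" "h' \<in> Hom C X (fobj S Y)" "Y \<in> Obj A"
  shows "\<phi> X Y h = \<phi> X Y h' \<longleftrightarrow> h = h'"
  using bij_betw_imp_inj_on[OF transpose_bij[OF C.Hom_Obj(1)[OF assms(1)] assms(3)]] assms(1,2)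
  by (auto dest: inj_onD)

lemma transpose_surj:
  assumes "l \<in> Hom A Y (fobj P X)" "X \<in> Obj C"
  obtains h where "h \<in> Hom C X (fobj S Y)" "\<phi> X Y h = l"
  using bij_betw_imp_surj_on[OF transpose_bij[OF assms(2) A.Hom_Obj(1)[OF assms(1)]]] assms(1)
  by (metis imageE)

lemma transpose_natural:
  assumes f: "f \<in> Hom C X' X" and u: "u \<in> Hom A Y' Y" and h: "h \<in> Hom C X (fobj S Y)"
  shows "\<phi> X' Y' (farr S u \<cdot>\<^bsub>C\<^esub> h \<cdot>\<^bsub>C\<^esub> f) = farr P f \<cdot>\<^bsub>A\<^esub> \<phi> X Y h \<cdot>\<^bsub>A\<^esub> u"
  using adj C.Hom_Obj[OF f] A.Hom_Obj[OF u] f u h unfolding dual_adjunction_def by blast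

text \<open>Naturality with \<open>u\<close> the identity on \<open>Y\<close>, which
  \<open>S\<close> preserves; the unit laws then remove it on both sides.\<close>

lemma transpose_natural_left:
  assumes f: "f \<in> Hom C X' X" and Y: "Y \<in> Obj A" and h: "h \<in> Hom C X (fobj S Y)"
  shows "\<phi> X' Y (h \<cdot>\<^bsub>C\<^esub> f) = farr P f \<cdot>\<^bsub>A\<^esub> \<phi> X Y h"
proof -
  have "farr P f \<cdot>\<^bsub>A\<^esub> \<phi> X Y h \<in> Hom A Y (fobj P X')"
    using A.Comp_closed[OF transpose_Hom[OF h Y] C.contravariant_Hom[OF P f]] .
  then show ?thesis
    using transpose_natural[OF f A.Ident_closed[OF Y] h] contravariant_Ident[OF S Y]
      C.Ident_left[OF h] A.Ident_right by simp
qed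

lemma adj_unit:
  assumes X: "X \<in> Obj C"
  shows "adj_unit C A P S \<phi> X \<in> Hom C X (fobj S (fobj P X))"
    and "\<phi> X (fobj P X) (adj_unit C A P S \<phi> X) = Ident A (fobj P X)"
proof -
  have PX: "fobj P X \<in> Obj A"
    by (rule contravariant_Obj[OF P X])
  note bij = transpose_bij[OF X PX] and id = A.Ident_closed[OF PX]
  show "adj_unit C A P S \<phi> X \<in> Hom C X (fobj S (fobj P X))"
    unfolding adj_unit_def
    using bij_betwE[OF bij_betw_the_inv_into[OF bij]] id by blast
  show "\<phi> X (fobj P X) (adj_unit C A P S \<phi> X) = Ident A (fobj P X)"
    unfolding adj_unit_def using f_the_inv_into_f_bij_betw[OF bij] id by blast
qed

text \<open>Transposition matches cones with apex \<open>Y\<close> over the \<open>P\<close>-image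
  of \<open>f\<close> and \<open>g\<close> with cocones under \<open>f\<close> and \<open>g\<close>
  with apex \<open>fobj S Y\<close>. The universal property of the pushout at such apexes is
  therefore that of the pullback.\<close>

lemma pushout_imp_pullback:
  assumes "is_pullback (op_cat C) f g s"
  shows "is_pullback A (farr P f) (farr P g)
    \<lparr>apex = fobj P (apex s), leg1 = farr P (leg1 s), leg2 = farr P (leg2 s)\<rparr>"
proof -
  define B X1 X2 Q where "B = Dom C f" and "X1 = Cod C f" and "X2 = Cod C g" and "Q = apex s"
  have f: "f \<in> Hom C B X1" and g: "g \<in> Hom C B X2"
    using assms by (auto simp: is_pullback_def Hom_def B_def X1_def X2_def)
  have Q: "Q \<in> Obj C" and i: "leg1 s \<in> Hom C X1 Q" "leg2 s \<in> Hom C X2 Q"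
    and comm: "leg1 s \<cdot>\<^bsub>C\<^esub> f = leg2 s \<cdot>\<^bsub>C\<^esub> g"
    using assms by (auto simp: is_pullback_def is_span_def X1_def X2_def Q_def)
  \<comment> \<open>The universal property in the opposite category, read as that of a pushout in
    \<open>C\<close>.\<close>
  have univ: "\<exists>!k. k \<in> Hom C Q Z \<and> k \<cdot>\<^bsub>C\<^esub> leg1 s = a \<and> k \<cdot>\<^bsub>C\<^esub> leg2 s = b"
    if "a \<in> Hom C X1 Z" "b \<in> Hom C X2 Z" "a \<cdot>\<^bsub>C\<^esub> f = b \<cdot>\<^bsub>C\<^esub> g" for Z a b
  proof -
    have "is_span (op_cat C) X1 X2 \<lparr>apex = Z, leg1 = a, leg2 = b\<rparr>"
      using that C.Hom_Obj by (auto simp: is_span_def)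
    with assms that(3) show ?thesis
      unfolding is_pullback_def X1_def X2_def Q_def
      by (elim conjE allE[of _ "\<lparr>apex = Z, leg1 = a, leg2 = b\<rparr>"]) simp
  qed
  note objs = C.Hom_Obj[OF f] C.Hom_Obj[OF g]
  note Pf = C.contravariant_Hom[OF P f] and Pg = C.contravariant_Hom[OF P g]
    and Pi = C.contravariant_Hom[OF P i(1)] C.contravariant_Hom[OF P i(2)]
  have ex1: "\<exists>!k. k \<in> Hom A Y (fobj P Q) \<and>
      farr P (leg1 s) \<cdot>\<^bsub>A\<^esub> k = l1 \<and> farr P (leg2 s) \<cdot>\<^bsub>A\<^esub> k = l2"
    if l: "l1 \<in> Hom A Y (fobj P X1)" "l2 \<in> Hom A Y (fobj P X2)"
      and l_comm: "farr P f \<cdot>\<^bsub>A\<^esub> l1 = farr P g \<cdot>\<^bsub>A\<^esub> l2" for Y l1 l2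
  proof -
    have Y: "Y \<in> Obj A"
      using A.Hom_Obj[OF l(1)] by blast
    obtain h1 where h1: "h1 \<in> Hom C X1 (fobj S Y)" "\<phi> X1 Y h1 = l1"
      using transpose_surj[OF l(1) objs(2)] .
    obtain h2 where h2: "h2 \<in> Hom C X2 (fobj S Y)" "\<phi> X2 Y h2 = l2"
      using transpose_surj[OF l(2) objs(4)] .
    \<comment> \<open>By naturality the two composites have equal transposes, and transposition is
      injective; so \<open>h1\<close> and \<open>h2\<close> form a cocone.\<close>
    have "h1 \<cdot>\<^bsub>C\<^esub> f = h2 \<cdot>\<^bsub>C\<^esub> g"
      using transpose_natural_left[OF f Y h1(1)] transpose_natural_left[OF g Y h2(1)] h1(2) h2(2)
        l_comm transpose_eq_iff[OF C.Comp_closed[OF f h1(1)] C.Comp_closed[OF g h2(1)] Y] by simp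
    note k_ex1 = univ[OF h1(1) h2(1) this]
    \<comment> \<open>Transposition carries mediating arrows of the cocone to mediating arrows of
      the cone, and reflects them.\<close>
    have legs_iff: "farr P (leg1 s) \<cdot>\<^bsub>A\<^esub> \<phi> Q Y k = l1 \<longleftrightarrow> k \<cdot>\<^bsub>C\<^esub> leg1 s = h1"
      "farr P (leg2 s) \<cdot>\<^bsub>A\<^esub> \<phi> Q Y k = l2 \<longleftrightarrow> k \<cdot>\<^bsub>C\<^esub> leg2 s = h2"
      if k: "k \<in> Hom C Q (fobj S Y)" for k
      using transpose_natural_left[OF i(1) Y k] transpose_natural_left[OF i(2) Y k] h1(2) h2(2)
        transpose_eq_iff[OF C.Comp_closed[OF i(1) k] h1(1) Y]
        transpose_eq_iff[OF C.Comp_closed[OF i(2) k] h2(1) Y] by simp_all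
    show ?thesis
    proof (rule ex_ex1I)
      show "\<exists>k. k \<in> Hom A Y (fobj P Q) \<and>
          farr P (leg1 s) \<cdot>\<^bsub>A\<^esub> k = l1 \<and> farr P (leg2 s) \<cdot>\<^bsub>A\<^esub> k = l2"
        using k_ex1 legs_iff transpose_Hom[OF _ Y] by blast
    next
      fix k k'
      assume k: "k \<in> Hom A Y (fobj P Q) \<and>
          farr P (leg1 s) \<cdot>\<^bsub>A\<^esub> k = l1 \<and> farr P (leg2 s) \<cdot>\<^bsub>A\<^esub> k = l2"
        and k': "k' \<in> Hom A Y (fobj P Q) \<and>
          farr P (leg1 s) \<cdot>\<^bsub>A\<^esub> k' = l1 \<and> farr P (leg2 s) \<cdot>\<^bsub>A\<^esub> k' = l2"
      \<comment> \<open>Uniqueness is pulled back to the pushout: by surjectivity both candidates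
        are transposes of arrows out of \<open>Q\<close>.\<close>
      obtain m where m: "m \<in> Hom C Q (fobj S Y)" "\<phi> Q Y m = k"
        using transpose_surj[OF conjunct1[OF k] Q] .
      obtain m' where m': "m' \<in> Hom C Q (fobj S Y)" "\<phi> Q Y m' = k'"
        using transpose_surj[OF conjunct1[OF k'] Q] .
      have "m = m'"
        using k_ex1 k k' m m' legs_iff[OF m(1)] legs_iff[OF m'(1)] by blast
      with m m' show "k = k'" by simp
    qed
  qed
  have "farr P f \<cdot>\<^bsub>A\<^esub> farr P (leg1 s) = farr P g \<cdot>\<^bsub>A\<^esub> farr P (leg2 s)"
    using C.contravariant_Comp[OF P f i(1)] C.contravariant_Comp[OF P g i(2)] comm by simp
  then show ?thesis
    unfolding is_pullback_def is_span_def HomD(2)[OF Pf] HomD(2)[OF Pg]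
    using HomD[OF Pf] HomD[OF Pg] Pi contravariant_Obj[OF P Q] ex1 by (simp add: Q_def)
qed

text \<open>The chosen span is a pullback once some pullback exists: either \<open>A\<close> has it,
  or it is the image under \<open>P\<close> of a pushout of the legs.\<close>

lemma dual_span_is_pullback:
  assumes "has_pullbacks A \<or> has_pushouts C" and s: "is_span C X1 X2 s"
  shows "is_pullback A (farr P (leg1 s)) (farr P (leg2 s)) (dual_span A P s)"
  unfolding dual_span_def
proof (rule is_pullback_pullback)
  note legs = span_Hom_legs[OF s]
  note Plegs = C.contravariant_Hom[OF P legs(2)] C.contravariant_Hom[OF P legs(3)]
  from assms(1) show "\<exists>t. is_pullback A (farr P (leg1 s)) (farr P (leg2 s)) t"
  proof
    assume "has_pullbacks A"
    then show ?thesis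
      unfolding has_pullbacks_def using HomD[OF Plegs(1)] HomD[OF Plegs(2)] by simp
  next
    assume "has_pushouts C"
    then show ?thesis
      unfolding has_pushouts_def has_pullbacks_def
      using HomD[OF legs(2)] HomD[OF legs(3)] pushout_imp_pullback by fastforce
  qed
qed

text \<open>The unit transposes to an identity, so by naturality only the arrows composed with it on
  either side survive: \<open>\<gamma> \<cdot> \<pi>\<close> as its image under \<open>P\<close>,
  and \<open>\<rho> X \<cdot> farr L p\<close> itself.\<close>

lemma sigma_transpose:
  assumes T: "is_functor C C T" and logic: "is_logic C A P T L \<rho>"
    and \<gamma>: "is_coalgebra C T X \<gamma>" and p: "p \<in> Hom A Y (fobj P X)" and \<pi>: "\<pi> \<in> Hom C B X"
  shows "sigma C A P S \<phi> T L \<rho> X p \<in> Hom C (fobj T X) (fobj S (fobj L Y))"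
    and "\<phi> B (fobj L Y) (sigma C A P S \<phi> T L \<rho> X p \<cdot>\<^bsub>C\<^esub> \<gamma> \<cdot>\<^bsub>C\<^esub> \<pi>) =
      farr P \<pi> \<cdot>\<^bsub>A\<^esub> complex_algebra A P \<rho> X \<gamma> \<cdot>\<^bsub>A\<^esub> farr L p"
proof -
  let ?\<eta> = "adj_unit C A P S \<phi> (fobj T X)"
  have X: "X \<in> Obj C" and \<gamma>_Hom: "\<gamma> \<in> Hom C X (fobj T X)"
    using \<gamma> by (auto simp: is_coalgebra_def)
  have TX: "fobj T X \<in> Obj C"
    using C.Hom_Obj[OF \<gamma>_Hom] by blast
  have L: "is_functor A A L" and \<rho>: "\<rho> X \<in> Hom A (fobj L (fobj P X)) (fobj P (fobj T X))"
    using logic X by (auto simp: is_logic_def natural_transformation_def fcomp_def)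
  note Lp = A.functor_Hom[OF L p] and \<eta> = adj_unit[OF TX]
  note SLp = A.contravariant_Hom[OF S Lp] and S\<rho> = A.contravariant_Hom[OF S \<rho>]
  note \<gamma>\<pi> = C.Comp_closed[OF \<pi> \<gamma>_Hom] and \<rho>Lp = A.Comp_closed[OF Lp \<rho>]
  note P\<gamma> = C.contravariant_Hom[OF P \<gamma>_Hom] and P\<pi> = C.contravariant_Hom[OF P \<pi>]
  show \<sigma>: "sigma C A P S \<phi> T L \<rho> X p \<in> Hom C (fobj T X) (fobj S (fobj L Y))"
    unfolding sigma_def using C.Comp_closed[OF \<eta>(1) C.Comp_closed[OF S\<rho> SLp]] .
  \<comment> \<open>Contravariance of \<open>S\<close> merges its two factors, giving the shape
    \<open>farr S u \<cdot> h \<cdot> f\<close> of the naturality law with the unit as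
    \<open>h\<close>.\<close>
  have "sigma C A P S \<phi> T L \<rho> X p \<cdot>\<^bsub>C\<^esub> \<gamma> \<cdot>\<^bsub>C\<^esub> \<pi> = farr S (\<rho> X \<cdot>\<^bsub>A\<^esub> farr L p) \<cdot>\<^bsub>C\<^esub> ?\<eta> \<cdot>\<^bsub>C\<^esub> (\<gamma> \<cdot>\<^bsub>C\<^esub> \<pi>)"
    using C.Comp_assoc[OF \<pi> \<gamma>_Hom \<sigma>] A.contravariant_Comp[OF S Lp \<rho>] by (simp add: sigma_def)
  then have "\<phi> B (fobj L Y) (sigma C A P S \<phi> T L \<rho> X p \<cdot>\<^bsub>C\<^esub> \<gamma> \<cdot>\<^bsub>C\<^esub> \<pi>) =
      farr P (\<gamma> \<cdot>\<^bsub>C\<^esub> \<pi>) \<cdot>\<^bsub>A\<^esub> Ident A (fobj P (fobj T X)) \<cdot>\<^bsub>A\<^esub> (\<rho> X \<cdot>\<^bsub>A\<^esub> farr L p)"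
    using transpose_natural[OF \<gamma>\<pi> \<rho>Lp \<eta>(1)] \<eta>(2) by simp
  also have "\<dots> = farr P \<pi> \<cdot>\<^bsub>A\<^esub> farr P \<gamma> \<cdot>\<^bsub>A\<^esub> (\<rho> X \<cdot>\<^bsub>A\<^esub> farr L p)"
    using A.Ident_right[OF C.contravariant_Hom[OF P \<gamma>\<pi>]] C.contravariant_Comp[OF P \<pi> \<gamma>_Hom] by simp
  also have "\<dots> = farr P \<pi> \<cdot>\<^bsub>A\<^esub> (farr P \<gamma> \<cdot>\<^bsub>A\<^esub> \<rho> X) \<cdot>\<^bsub>A\<^esub> farr L p"
    using A.Comp_assoc[OF Lp \<rho> A.Comp_closed[OF P\<gamma> P\<pi>]] A.Comp_assoc[OF \<rho> P\<gamma> P\<pi>] by simp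
  finally show "\<phi> B (fobj L Y) (sigma C A P S \<phi> T L \<rho> X p \<cdot>\<^bsub>C\<^esub> \<gamma> \<cdot>\<^bsub>C\<^esub> \<pi>) =
      farr P \<pi> \<cdot>\<^bsub>A\<^esub> complex_algebra A P \<rho> X \<gamma> \<cdot>\<^bsub>A\<^esub> farr L p"
    by (simp add: complex_algebra_def)
qed

end

section \<open>Bisimulations as post-fixed points\<close>

theorem theorem3p21:
  fixes C :: "('o, 'a) cat" and A :: "('p, 'b) cat"
    and P :: "('o, 'a, 'p, 'b) fctr" and S :: "('p, 'b, 'o, 'a) fctr"
    and \<phi> :: "'o \<Rightarrow> 'p \<Rightarrow> 'a \<Rightarrow> 'b"
    and T :: "('o, 'a, 'o, 'a) fctr" and L :: "('p, 'b, 'p, 'b) fctr" and \<rho> :: "'o \<Rightarrow> 'b"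
    and E :: "'a set" and U :: "'u set"
    and X1 X2 :: 'o and \<gamma>1 \<gamma>2 :: 'a and B :: 'o and \<pi>1 \<pi>2 :: 'a
  assumes "category C" and "category A"
    and "finitely_complete C" and "well_powered U C"
    and "factorisation_system C E {m. monic C m}"
    and "has_pullbacks A \<or> has_pushouts C"
    and "dual_adjunction C A P S \<phi>"
    and "is_functor C C T"
    and "is_logic C A P T L \<rho>"
    and "is_coalgebra C T X1 \<gamma>1" and "is_coalgebra C T X2 \<gamma>2"
    and "is_span C X1 X2 \<lparr>apex = B, leg1 = \<pi>1, leg2 = \<pi>2\<rparr>"
    and "jointly_mono C \<lparr>apex = B, leg1 = \<pi>1, leg2 = \<pi>2\<rparr>"
  shows "rho_bisimulation A P L \<rho> X1 \<gamma>1 X2 \<gamma>2 \<lparr>apex = B, leg1 = \<pi>1, leg2 = \<pi>2\<rparr> \<longleftrightarrow>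
    rel_le C X1 X2
      (rel_class C X1 X2 \<lparr>apex = B, leg1 = \<pi>1, leg2 = \<pi>2\<rparr>)
      (T_rho C A P S \<phi> T L \<rho> X1 \<gamma>1 X2 \<gamma>2 \<lparr>apex = B, leg1 = \<pi>1, leg2 = \<pi>2\<rparr>)"
proof -
  interpret dual_adjoint C A P S \<phi>
    using assms by (simp add: dual_adjoint_def dual_adjoint_axioms_def)
  let ?s = "\<lparr>apex = B, leg1 = \<pi>1, leg2 = \<pi>2\<rparr>"
  let ?d = "dual_span A P ?s"
  let ?f = "sigma C A P S \<phi> T L \<rho> X1 (leg1 ?d) \<cdot>\<^bsub>C\<^esub> \<gamma>1"
  let ?g = "sigma C A P S \<phi> T L \<rho> X2 (leg2 ?d) \<cdot>\<^bsub>C\<^esub> \<gamma>2"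
  note s = \<open>is_span C X1 X2 ?s\<close>
  have \<pi>: "\<pi>1 \<in> Hom C B X1" "\<pi>2 \<in> Hom C B X2"
    using s by (auto simp: is_span_def)
  have \<gamma>: "\<gamma>1 \<in> Hom C X1 (fobj T X1)" "\<gamma>2 \<in> Hom C X2 (fobj T X2)"
    using assms by (auto simp: is_coalgebra_def)
  \<comment> \<open>The legs of the dual span thus have the type that the transposition formula
    expects of \<open>p\<close>, with a common \<open>Y\<close>, its apex.\<close>
  have "is_span A (fobj P X1) (fobj P X2) ?d"
    using dual_span_is_pullback[OF \<open>has_pullbacks A \<or> has_pushouts C\<close> s]
      HomD[OF C.contravariant_Hom[OF P \<pi>(1)]] HomD[OF C.contravariant_Hom[OF P \<pi>(2)]]
    by (simp add: is_pullback_def)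
  note d = span_Hom_legs[OF this]
  note \<sigma>1 = sigma_transpose[OF \<open>is_functor C C T\<close> \<open>is_logic C A P T L \<rho>\<close> \<open>is_coalgebra C T X1 \<gamma>1\<close> d(2) \<pi>(1)]
    and \<sigma>2 = sigma_transpose[OF \<open>is_functor C C T\<close> \<open>is_logic C A P T L \<rho>\<close> \<open>is_coalgebra C T X2 \<gamma>2\<close> d(3) \<pi>(2)]
  have f: "?f \<in> Hom C X1 (fobj S (fobj L (apex ?d)))" and g: "?g \<in> Hom C X2 (fobj S (fobj L (apex ?d)))"
    using C.Comp_closed[OF \<gamma>(1) \<sigma>1(1)] C.Comp_closed[OF \<gamma>(2) \<sigma>2(1)] .
  have LY: "fobj L (apex ?d) \<in> Obj A"
    using d(1) \<open>is_logic C A P T L \<rho>\<close> by (simp add: is_logic_def is_functor_def)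
  have pb: "is_pullback C ?f ?g (pullback C ?f ?g)"
    using C.finitely_complete_has_pullbacks[OF \<open>finitely_complete C\<close>] HomD[OF f] HomD[OF g]
    by (intro is_pullback_pullback) (simp add: has_pullbacks_def)
  have pb_jm: "pullback C ?f ?g \<in> jm_spans C X1 X2"
    using pb C.pullback_jointly_mono[OF pb] HomD[OF f] HomD[OF g]
    by (simp add: jm_spans_def is_pullback_def)
  have s_jm: "?s \<in> jm_spans C X1 X2"
    using assms by (simp add: jm_spans_def)
  \<comment> \<open>The two sides of the bisimulation equation are the transposes of the two
    composites, and transposition is injective.\<close>
  have "rho_bisimulation A P L \<rho> X1 \<gamma>1 X2 \<gamma>2 ?s \<longleftrightarrow> ?f \<cdot>\<^bsub>C\<^esub> \<pi>1 = ?g \<cdot>\<^bsub>C\<^esub> \<pi>2"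
    unfolding rho_bisimulation_def
    using \<sigma>1(2) \<sigma>2(2) transpose_eq_iff[OF C.Comp_closed[OF \<pi>(1) f] C.Comp_closed[OF \<pi>(2) g] LY] by simp
  also have "\<dots> \<longleftrightarrow> span_le C ?s (pullback C ?f ?g)"
    using C.span_le_pullback_iff[OF pb, of ?s] s HomD[OF f] HomD[OF g] by simp
  \<comment> \<open>\<open>T_rho\<close> is the class of this pullback, so the comparison of classes
    is one of the given representatives.\<close>
  also have "\<dots> \<longleftrightarrow> rel_le C X1 X2 (rel_class C X1 X2 ?s) (T_rho C A P S \<phi> T L \<rho> X1 \<gamma>1 X2 \<gamma>2 ?s)"
    unfolding T_rho_def using C.rel_le_rel_class_iff[OF s_jm pb_jm] by simp
  finally show ?thesis .
qed

end
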